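(* For any $F\in\mathcal{S}$, $k\in\mathbb{N}$ and $j\in\{1,\dots,d\}$, for $\mathbb{P}$-almost every $w\in\Omega$, $$D_k^jF(w)=\sum_{i=0}^dc_i^j(k)F(w_i^k),$$ where $c_i^j(k)=\mathbb{P}(X_k=i\,|\,\mathcal{F}_{k-1})\,Y_k^j(w_i^k)=p_k^iv_i^j(k)$ and $w_i^k=(w_0,\dots,w_{k-1},i,w_{k+1},\dots)$ is $w$ with its $k$-th coordinate replaced by $i$.
   Context: Let $d\ge1$, $\Omega=\{0,\dots,d\}^{\mathbb{N}}$ ($0\in\mathbb{N}$) with its product $\sigma$-field, coordinate maps $X_n(w)=w_n$, $\mathcal{F}_n=\sigma(X_0,\dots,X_n)$, $\mathcal{F}_{-1}=\{\varnothing,\Omega\}$. Assume i.i.d. increments: under $\mathbb{P}$ the $X_n$ are i.i.d. with $p_n^i=\mathbb{P}(X_n=i)=p^i>0$, and $Y_n=v_{X_n}(n)$ with $v_i(n)=v_i\in\mathbb{R}^d$ fixed vectors, $i=0,\dots,d$, such that $\mathbb{E}[Y_n^j]=0$ and $\mathbb{E}[Y_n^jY_n^l]=\delta^{jl}$ for $1\le j,l\le d$. Multiple integrals: $\Delta_r=\{(i_1,\dots,i_r)\in\mathbb{N}^r: i_l\ne i_k \text{ for } l\neq k\}$. A function $f_r=(f_r^{k_1,\dots,k_r})_{1\le k_1,\dots,k_r\le d}:\Delta_r\to\mathbb{R}^{d^r}$ is symmetric if $f_r^{k_{\sigma(1)},\dots,k_{\sigma(r)}}(i_{\sigma(1)},\dots,i_{\sigma(r)})=f_r^{k_1,\dots,k_r}(i_1,\dots,i_r)$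 for every permutation $\sigma$. For symmetric square-summable $f_r\in L^2(\Delta_r,\mathbb{R}^{d^r})$, $r\ge1$, $\mathcal{I}^r(f_r)=\sum_{k_1,\dots,k_r=1}^d\sum_{(i_1,\dots,i_r)\in\Delta_r}f_r^{k_1,\dots,k_r}(i_1,\dots,i_r)Y_{i_1}^{k_1}\cdots Y_{i_r}^{k_r}$ (convergence in $L^2(\Omega)$), and $\mathcal{I}^0(f_0)=f_0$ for $f_0\in\mathbb{R}$. $\mathcal{S}$ is the space of finite sums $\sum_{r=0}^n\mathcal{I}^r(f_r)$ with $f_r$ symmetric in $L^2(\Delta_r,\mathbb{R}^{d^r})$. Gradient: $D_k^j$ is the linear operator on $\mathcal{S}$ with $D_k^j\mathcal{I}^0(f_0)=0$ and $D_k^j\mathcal{I}^r(f_r)=r\,\mathcal{I}^{r-1}\big(f_r^j( *,k)1_{\Delta_r}( *,k)\big)$ for $r\ge1$, where $f_r^j( *,k)1_{\Delta_r}( *,k)$ is the function on $\Delta_{r-1}$ with components $(i_1,\dots,i_{r-1})\mapsto f_r^{k_1,\dots,k_{r-1},j}(i_1,\dots,i_{r-1},k)$ if $k\notin\{i_1,\dots,i_{r-1}\}$ and $0$ otherwise. *)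

theory Defs
  imports "HOL-Probability.Probability" "HOL-Combinatorics.Permutations"
begin

text \<open>
  The integer \<open>d\<close> is \<open>CARD('d)\<close>, so that \<open>real ^ 'd\<close> is Euclidean \<open>d\<close>-space and upper indices
  range over \<open>'d\<close>.  A path \<open>w :: nat \<Rightarrow> nat\<close> takes values in \<open>{0..CARD('d)}\<close>.
  Square-integrable random variables are represented by functions, identified up to null sets.
\<close>

definition incr :: "(nat \<Rightarrow> real ^ 'd) \<Rightarrow> nat \<Rightarrow> (nat \<Rightarrow> nat) \<Rightarrow> real ^ 'd" where
  "incr v n w = v (w n)"

text \<open>
  \<open>past M k\<close> is the \<open>\<sigma>\<close>-field generated by the coordinates strictly before \<open>k\<close>; for \<open>k = 0\<close> it
  is trivial.
\<close>

definition past :: "(nat \<Rightarrow> nat) measure \<Rightarrow> nat \<Rightarrow> (nat \<Rightarrow> nat) measure" where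
  "past M k = sigma (space M) {(\<lambda>w. w m) -` B \<inter> space M | m B. m < k}"

definition grad_coeff ::
  "(nat \<Rightarrow> nat) measure \<Rightarrow> (nat \<Rightarrow> real ^ 'd) \<Rightarrow> nat \<Rightarrow> 'd \<Rightarrow> nat \<Rightarrow> (nat \<Rightarrow> nat) \<Rightarrow> real" where
  "grad_coeff M v k j i w =
     real_cond_exp M (past M k) (indicator {w' \<in> space M. w' k = i}) w
       * incr v k (w(k := i)) $ j"

definition Delta :: "nat \<Rightarrow> nat list set" where
  "Delta r = {is. length is = r \<and> distinct is}"

text \<open>
  A kernel \<open>f :: 'd list \<Rightarrow> nat list \<Rightarrow> real\<close> of order \<open>r\<close> takes the upper indices
  \<open>[k\<^sub>1, \<dots>, k\<^sub>r]\<close> and the time indices \<open>[i\<^sub>1, \<dots>, i\<^sub>r]\<close>; only its values on lists of length \<open>r\<close>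
  with distinct time indices matter.
\<close>

definition symmetric_kernel :: "nat \<Rightarrow> ('d list \<Rightarrow> nat list \<Rightarrow> real) \<Rightarrow> bool" where
  "symmetric_kernel r f \<longleftrightarrow>
     (\<forall>\<sigma> ks is. \<sigma> permutes {..<r} \<longrightarrow> length ks = r \<longrightarrow> is \<in> Delta r \<longrightarrow>
        f (permute_list \<sigma> ks) (permute_list \<sigma> is) = f ks is)"

definition square_summable_kernel :: "nat \<Rightarrow> ('d::finite list \<Rightarrow> nat list \<Rightarrow> real) \<Rightarrow> bool" where
  "square_summable_kernel r f \<longleftrightarrow>
     (\<lambda>is. \<Sum>ks | length ks = r. (f ks is)\<^sup>2) summable_on Delta r"

definition partial_integral ::
  "(nat \<Rightarrow> real ^ 'd) \<Rightarrow> nat \<Rightarrow> ('d::finite list \<Rightarrow> nat list \<Rightarrow> real) \<Rightarrow> nat list set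
     \<Rightarrow> (nat \<Rightarrow> nat) \<Rightarrow> real" where
  "partial_integral v r f A w =
     (\<Sum>is\<in>A. \<Sum>ks | length ks = r. f ks is * (\<Prod>l<r. incr v (is ! l) w $ (ks ! l)))"

text \<open>
  \<open>F\<close> is a version of the multiple integral of order \<open>r\<close> of \<open>f\<close>: the series over \<open>Delta r\<close>
  converges to \<open>F\<close> in \<open>L\<^sup>2\<close>, as a limit over the finite subsets of \<open>Delta r\<close>.  For \<open>r = 0\<close> the
  only index is the empty tuple, so \<open>F\<close> is almost surely the constant \<open>f [] []\<close>.
\<close>

definition has_multiple_integral ::
  "(nat \<Rightarrow> nat) measure \<Rightarrow> (nat \<Rightarrow> real ^ 'd) \<Rightarrow> nat \<Rightarrow> ('d::finite list \<Rightarrow> nat list \<Rightarrow> real)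
     \<Rightarrow> ((nat \<Rightarrow> nat) \<Rightarrow> real) \<Rightarrow> bool" where
  "has_multiple_integral M v r f F \<longleftrightarrow>
     F \<in> borel_measurable M \<and> integrable M (\<lambda>w. (F w)\<^sup>2) \<and>
     ((\<lambda>A. \<integral>w. (F w - partial_integral v r f A w)\<^sup>2 \<partial>M) \<longlongrightarrow> 0) (finite_subsets_at_top (Delta r))"

definition chaos_expansion ::
  "(nat \<Rightarrow> nat) measure \<Rightarrow> (nat \<Rightarrow> real ^ 'd) \<Rightarrow> nat
     \<Rightarrow> (nat \<Rightarrow> 'd::finite list \<Rightarrow> nat list \<Rightarrow> real) \<Rightarrow> ((nat \<Rightarrow> nat) \<Rightarrow> real) \<Rightarrow> bool" where
  "chaos_expansion M v n f F \<longleftrightarrow>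
     F \<in> borel_measurable M \<and>
     (\<forall>r\<le>n. symmetric_kernel r (f r) \<and> square_summable_kernel r (f r)) \<and>
     (\<exists>I. (\<forall>r\<le>n. has_multiple_integral M v r (f r) (I r)) \<and>
          (AE w in M. F w = (\<Sum>r\<le>n. I r w)))"

definition chaos_space ::
  "(nat \<Rightarrow> nat) measure \<Rightarrow> (nat \<Rightarrow> real ^ 'd::finite) \<Rightarrow> ((nat \<Rightarrow> nat) \<Rightarrow> real) set" where
  "chaos_space M v = {F. \<exists>n f. chaos_expansion M v n f F}"

definition contract_kernel ::
  "('d list \<Rightarrow> nat list \<Rightarrow> real) \<Rightarrow> 'd \<Rightarrow> nat \<Rightarrow> 'd list \<Rightarrow> nat list \<Rightarrow> real" where
  "contract_kernel f j k ks is = (if k \<in> set is then 0 else f (ks @ [j]) (is @ [k]))"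

text \<open>
  The linear extension of the action on single multiple integrals: the gradient of
  \<open>\<Sum>r\<le>n. I\<^sup>r (f r)\<close> is \<open>\<Sum>r=1..n. r I\<^sup>r\<^sup>-\<^sup>1 (contract_kernel (f r) j k)\<close>.  Under the standing
  assumptions the kernels of an element of \<open>chaos_space\<close> are unique, so the choice below is
  determined up to null sets.
\<close>

definition gradient ::
  "(nat \<Rightarrow> nat) measure \<Rightarrow> (nat \<Rightarrow> real ^ 'd::finite) \<Rightarrow> nat \<Rightarrow> 'd \<Rightarrow> ((nat \<Rightarrow> nat) \<Rightarrow> real)
     \<Rightarrow> (nat \<Rightarrow> nat) \<Rightarrow> real" where
  "gradient M v k j F =
     (SOME G. \<exists>n f J. chaos_expansion M v n f F \<and>
        (\<forall>r\<in>{1..n}. has_multiple_integral M v (r - 1) (contract_kernel (f r) j k) (J r)) \<and>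
        G \<in> borel_measurable M \<and> (AE w in M. G w = (\<Sum>r=1..n. real r * J r w)))"

end

theory Submission
  imports Defs
begin

text \<open>
  Write \<open>T F w = (\<Sum>i. p i * v i $ j * F (w(k := i)))\<close> for the right-hand side of the claim.  The
  coordinates are independent, so replacing the \<open>k\<close>-th coordinate of a random path by an
  independent copy leaves the law unchanged (\<open>nn_integral_resample\<close>).  This and the moment
  conditions on the increments give three facts that carry the proof.

  First, an event of the past of \<open>k\<close> does not see the \<open>k\<close>-th coordinate, hence is independent of it,
  and the conditional probabilities in the coefficients are the constants \<open>p i\<close>
  (\<open>grad_coeff_eq\<close>).

  Second, \<open>T\<close> respects null sets and, by Cauchy--Schwarz and \<open>E (Y\<^sup>j)\<^sup>2 = 1\<close>, is a contraction of
  \<open>L\<^sup>2\<close> (\<open>coordinate_gradient_L2_contraction\<close>).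

  Third, the moment conditions \<open>E Y\<^sup>j = 0\<close> and \<open>E Y\<^sup>j Y\<^sup>a = \<delta>\<close> say that \<open>T\<close> kills every product of
  increments that avoids time \<open>k\<close>, and from a product containing \<open>Y\<^sub>k\<^sup>a\<close> it removes this factor
  when \<open>a = j\<close> and annihilates the product otherwise.  For a symmetric kernel of order \<open>r\<close> the
  time \<open>k\<close> may sit in any of \<open>r\<close> positions with the same effect, so on finite sums \<open>T\<close> is \<open>r\<close>
  times the integral of the contracted kernel (\<open>coordinate_gradient_partial_integral\<close>).

  Approximation by finite sums together with the contraction property extends the last identity to
  all multiple integrals, and shows at the same time that the contracted kernels do have multiple
  integrals (\<open>has_multiple_integral_contract\<close>).  Since \<open>T F\<close> is given by a formula in \<open>F\<close> alone, every
  chaos expansion of \<open>F\<close> yields the same gradient almost surely, whichever one the choice operator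
  in the definition of the gradient picks.
\<close>

section \<open>Resampling one coordinate\<close>

locale iid_increments = prob_space M
  for M :: "(nat \<Rightarrow> nat) measure" +
  fixes p :: "nat \<Rightarrow> real"
    and v :: "nat \<Rightarrow> real ^ 'd::finite"
  assumes sets_M: "sets M = sets (Pi\<^sub>M UNIV (\<lambda>_. count_space {0..CARD('d)}))"
    and indep: "indep_vars (\<lambda>_. count_space {0..CARD('d)}) (\<lambda>n w. w n) UNIV"
    and marginal: "\<And>n i. i \<le> CARD('d) \<Longrightarrow> prob {w \<in> space M. w n = i} = p i"
    and p_pos: "\<And>i. i \<le> CARD('d) \<Longrightarrow> p i > 0"
    and mean_zero: "\<And>n a. (\<integral>w. incr v n w $ a \<partial>M) = 0"
    and covariance:
      "\<And>n a b. (\<integral>w. incr v n w $ a * incr v n w $ b \<partial>M) = (if a = b then 1 else 0)"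
begin

lemma space_M: "space M = UNIV \<rightarrow>\<^sub>E {0..CARD('d)}"
  using sets_eq_imp_space_eq[OF sets_M] by (simp add: space_PiM)

lemma coordinate_le: "w \<in> space M \<Longrightarrow> w n \<le> CARD('d)"
  by (auto simp: space_M PiE_iff)

lemma measurable_coordinate [measurable]: "(\<lambda>w. w n) \<in> measurable M (count_space {0..CARD('d)})"
  unfolding measurable_cong_sets[OF sets_M refl] by measurable

lemma measurable_fun_coordinate [measurable]: "(\<lambda>w. g (w n)) \<in> borel_measurable M"
  by (rule measurable_compose[OF measurable_coordinate]) simp

lemma fun_upd_in_space: "w \<in> space M \<Longrightarrow> i \<le> CARD('d) \<Longrightarrow> w(k := i) \<in> space M"
  by (auto simp: space_M PiE_iff)

lemma measurable_fun_upd_M [measurable (raw)]: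
  assumes "i \<le> CARD('d)"
  shows "(\<lambda>w. w(k := i)) \<in> measurable M M"
proof -
  have "(\<lambda>w. (w(k := i)) n) \<in> measurable M (count_space {0..CARD('d)})" for n
    using assms by (cases "n = k") auto
  then have "(\<lambda>w. w(k := i)) \<in> measurable M (Pi\<^sub>M UNIV (\<lambda>_. count_space {0..CARD('d)}))"
    by (intro measurable_PiM_single') (auto simp: space_M assms)
  then show ?thesis
    unfolding measurable_cong_sets[OF refl sets_M] .
qed

lemma marginal_event: "{w \<in> space M. w n = i} \<in> sets M"
  if "i \<le> CARD('d)"
proof -
  have "(\<lambda>w. w n) -` {i} \<inter> space M \<in> sets M"
    using that by (intro measurable_sets[OF measurable_coordinate]) auto
  also have "(\<lambda>w. w n) -` {i} \<inter> space M = {w \<in> space M. w n = i}" by auto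
  finally show ?thesis .
qed

lemma marginal_distr:
  "distr M (count_space {0..CARD('d)}) (\<lambda>w. w n) = point_measure {..CARD('d)} (\<lambda>i. ennreal (p i))"
proof (rule measure_eqI_finite[where A = "{..CARD('d)}"])
  fix i assume i: "i \<in> {..CARD('d)}"
  have "emeasure (distr M (count_space {0..CARD('d)}) (\<lambda>w. w n)) {i}
      = emeasure M ((\<lambda>w. w n) -` {i} \<inter> space M)"
    using i by (subst emeasure_distr) auto
  also have "(\<lambda>w. w n) -` {i} \<inter> space M = {w \<in> space M. w n = i}" by auto
  also have "emeasure M \<dots> = ennreal (p i)"
    using i marginal[of i n] by (simp add: emeasure_eq_measure)
  finally show "emeasure (distr M (count_space {0..CARD('d)}) (\<lambda>w. w n)) {i}
      = emeasure (point_measure {..CARD('d)} (\<lambda>i. ennreal (p i))) {i}"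
    using i by (simp add: emeasure_point_measure_finite)
qed (auto simp: sets_point_measure atLeast0AtMost)

lemma sum_marginal: "(\<Sum>i\<le>CARD('d). ennreal (p i)) = 1"
proof -
  have "prob_space (distr M (count_space {0..CARD('d)}) (\<lambda>w. w 0))"
    by (rule prob_space_distr) simp
  from prob_space.emeasure_space_1[OF this[unfolded marginal_distr]]
  show ?thesis
    by (simp add: space_point_measure emeasure_point_measure_finite)
qed

text \<open>
  Under independence the law of the path is the product of the law of the \<open>k\<close>-th coordinate and the
  law \<open>R\<close> of the remaining ones.  Fubini writes both sides in terms of \<open>R\<close>: once \<open>k\<close> has been
  overwritten, integrating over the original \<open>k\<close>-th coordinate contributes the total mass \<open>1\<close>.
\<close>

lemma nn_integral_resample:
  fixes F :: "(nat \<Rightarrow> nat) \<Rightarrow> ennreal"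
  assumes F [measurable]: "F \<in> borel_measurable M"
  shows "(\<integral>\<^sup>+w. F w \<partial>M) = (\<Sum>i\<le>CARD('d). ennreal (p i) * (\<integral>\<^sup>+w. F (w(k := i)) \<partial>M))"
proof -
  define C where "C n = distr M (count_space {0..CARD('d)}) (\<lambda>w. w n)" for n
  define R where "R = Pi\<^sub>M (UNIV - {k}) C"
  have C: "prob_space (C n)" for n
    unfolding C_def by (rule prob_space_distr) simp
  interpret R: prob_space R
    unfolding R_def by (rule prob_space_PiM) (rule C)
  have "M = distr M (Pi\<^sub>M UNIV (\<lambda>_. count_space {0..CARD('d)})) (\<lambda>w. \<lambda>i\<in>UNIV. w i)"
    by (simp add: restrict_UNIV distr_id2[OF sets_M[symmetric]])
  also have "\<dots> = Pi\<^sub>M UNIV C"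
    using indep unfolding C_def by (subst (asm) indep_vars_iff_distr_eq_PiM) auto
  finally have M_eq: "M = Pi\<^sub>M UNIV C" .
  have M_distr: "M = distr (C k \<Otimes>\<^sub>M R) M (\<lambda>(x, X). X(k := x))"
    using distr_pair_PiM_eq_PiM[of "UNIV - {k}" C k] C
    by (simp add: R_def insert_UNIV insert_absorb flip: M_eq)
  have upd [measurable]: "(\<lambda>(x, X). X(k := x)) \<in> measurable (C k \<Otimes>\<^sub>M R) M"
    using measurable_fun_upd[of UNIV "UNIV - {k}" k snd "C k \<Otimes>\<^sub>M R" C fst]
    by (simp add: R_def M_eq split_beta' insert_absorb)
  \<comment> \<open>Fubini, with the \<open>k\<close>-th coordinate integrated last.\<close>
  have split: "(\<integral>\<^sup>+w. G w \<partial>M) = (\<Sum>i\<le>CARD('d). ennreal (p i) * (\<integral>\<^sup>+X. G (X(k := i)) \<partial>R))"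
    if G [measurable]: "G \<in> borel_measurable M" for G :: "(nat \<Rightarrow> nat) \<Rightarrow> ennreal"
  proof -
    have "(\<integral>\<^sup>+w. G w \<partial>M) = (\<integral>\<^sup>+(x, X). G (X(k := x)) \<partial>(C k \<Otimes>\<^sub>M R))"
      by (subst M_distr, subst nn_integral_distr) (auto simp: split_beta')
    also have "\<dots> = (\<integral>\<^sup>+x. (\<integral>\<^sup>+X. G (X(k := x)) \<partial>R) \<partial>C k)"
      using R.nn_integral_fst[of "\<lambda>(x, X). G (X(k := x))" "C k", symmetric] by simp
    also have "\<dots> = (\<Sum>i\<le>CARD('d). ennreal (p i) * (\<integral>\<^sup>+X. G (X(k := i)) \<partial>R))"
      unfolding C_def marginal_distr by (subst nn_integral_point_measure_finite) auto
    finally show ?thesis .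
  qed
  have overwritten: "(\<integral>\<^sup>+w. F (w(k := i)) \<partial>M) = (\<integral>\<^sup>+X. F (X(k := i)) \<partial>R)" if "i \<le> CARD('d)" for i
    using split[of "\<lambda>w. F (w(k := i))"] that sum_marginal
    by (simp flip: sum_distrib_right)
  show ?thesis
    unfolding split[OF F] by (intro sum.cong) (auto simp: overwritten)
qed

text \<open>
  Positivity of \<open>p i\<close> enters here: overwriting \<open>w k\<close> by \<open>i\<close> amounts to conditioning on \<open>w k = i\<close>, an
  event of positive probability.  Hence the value of \<open>F (w(k := i))\<close> is determined up to null sets
  by the class of \<open>F\<close>.
\<close>

lemma AE_resample:
  assumes P: "AE w in M. P w" and i: "i \<le> CARD('d)"
  shows "AE w in M. P (w(k := i))"
proof -
  obtain N where N: "{w \<in> space M. \<not> P w} \<subseteq> N" "N \<in> sets M" "emeasure M N = 0"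
    using P by (auto elim: AE_E)
  note N(2)[measurable]
  have "0 = (\<integral>\<^sup>+w. indicator N w \<partial>M)" using N by simp
  also have "\<dots> = (\<Sum>i\<le>CARD('d). ennreal (p i) * (\<integral>\<^sup>+w. indicator N (w(k := i)) \<partial>M))"
    by (rule nn_integral_resample) simp
  finally have "ennreal (p i) * (\<integral>\<^sup>+w. indicator N (w(k := i)) \<partial>M) = 0"
    using i by (metis (no_types, lifting) atMost_iff finite_atMost sum_eq_0_iff)
  then have "(\<integral>\<^sup>+w. indicator N (w(k := i)) \<partial>M) = 0"
    using p_pos[OF i] by simp
  then have "AE w in M. (indicator N (w(k := i)) :: ennreal) = 0"
    using i by (subst (asm) nn_integral_0_iff_AE) auto
  with AE_space show ?thesis
  proof eventually_elim
    case (elim w)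
    then have "w(k := i) \<notin> N" "w(k := i) \<in> space M"
      using i by (auto simp: fun_upd_in_space indicator_def simp del: fun_upd_apply split: if_splits)
    then show ?case using N(1) by blast
  qed
qed

lemma expectation_coordinate: "(\<integral>w. g (w n) \<partial>M) = (\<Sum>i\<le>CARD('d). p i * g i)"
  for g :: "nat \<Rightarrow> real"
proof -
  have "(\<integral>w. g (w n) \<partial>M) = (\<integral>i. g i \<partial>distr M (count_space {0..CARD('d)}) (\<lambda>w. w n))"
    by (subst integral_distr) auto
  also have "\<dots> = (\<Sum>i\<le>CARD('d). p i * g i)"
    unfolding marginal_distr
    by (subst lebesgue_integral_point_measure_finite) (auto simp: p_pos less_imp_le)
  finally show ?thesis .
qed

lemma increment_mean: "(\<Sum>i\<le>CARD('d). p i * v i $ a) = 0"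
  using expectation_coordinate[of "\<lambda>i. v i $ a" 0] mean_zero[of 0 a] by (simp add: incr_def)

lemma increment_covariance:
  "(\<Sum>i\<le>CARD('d). p i * (v i $ a * v i $ b)) = (if a = b then 1 else 0)"
  using expectation_coordinate[of "\<lambda>i. v i $ a * v i $ b" 0] covariance[of 0 a b]
  by (simp add: incr_def)

section \<open>Conditional probabilities given the past\<close>

text \<open>
  The generators involve only coordinates different from \<open>k\<close>, and invariance under overwriting \<open>w k\<close>
  is stable under complements and countable unions.
\<close>

lemma past_invariant:
  assumes "A \<in> sets (past M k)" "i \<le> CARD('d)" "w \<in> space M"
  shows "w(k := i) \<in> A \<longleftrightarrow> w \<in> A"
proof -
  let ?G = "{(\<lambda>w. w m) -` B \<inter> space M | m B. m < k}"
  have "A \<in> sigma_sets (space M) ?G"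
    using assms(1) unfolding past_def by (subst (asm) sets_measure_of) auto
  moreover have "w(k := i) \<in> space M"
    using assms(2,3) by (rule fun_upd_in_space[rotated])
  ultimately show ?thesis
    by induction (use assms(3) in auto)
qed

lemma subalgebra_past: "subalgebra M (past M k)"
proof -
  let ?G = "{(\<lambda>w. w m) -` B \<inter> space M | m B. m < k}"
  have "(\<lambda>w. w m) -` B \<inter> space M \<in> sets M" for m :: nat and B
  proof -
    have "(\<lambda>w. w m) -` (B \<inter> {0..CARD('d)}) \<inter> space M \<in> sets M"
      by (rule measurable_sets[OF measurable_coordinate]) simp
    also have "(\<lambda>w. w m) -` (B \<inter> {0..CARD('d)}) \<inter> space M = (\<lambda>w. w m) -` B \<inter> space M"
      by (auto simp: coordinate_le)
    finally show ?thesis .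
  qed
  then have "sigma_sets (space M) ?G \<subseteq> sets M"
    by (intro sets.sigma_sets_subset) auto
  then show ?thesis
    unfolding subalgebra_def past_def by (subst space_measure_of, blast, subst sets_measure_of) auto
qed

text \<open>
  Independence of the past from the \<open>k\<close>-th coordinate, read off from resampling: after overwriting
  \<open>w k\<close> by \<open>i'\<close>, membership in \<open>A\<close> is unchanged and the second event becomes \<open>i' = i\<close>.
\<close>

lemma prob_past_inter:
  assumes A: "A \<in> sets (past M k)" and i: "i \<le> CARD('d)"
  shows "prob (A \<inter> {w \<in> space M. w k = i}) = prob A * p i"
proof -
  have AM: "A \<in> sets M" using A subalgebra_past by (auto simp: subalgebra_def)
  let ?B = "A \<inter> {w \<in> space M. w k = i}"
  have B [measurable]: "?B \<in> sets M" using AM marginal_event[OF i] by auto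
  have "emeasure M ?B = (\<integral>\<^sup>+w. indicator ?B w \<partial>M)" by simp
  also have "\<dots> = (\<Sum>i'\<le>CARD('d). ennreal (p i') * (\<integral>\<^sup>+w. indicator ?B (w(k := i')) \<partial>M))"
    by (rule nn_integral_resample) simp
  also have "\<dots> = (\<Sum>i'\<le>CARD('d). if i' = i then ennreal (p i) * emeasure M A else 0)"
  proof (rule sum.cong, goal_cases)
    case (2 i')
    have "(\<integral>\<^sup>+w. indicator ?B (w(k := i')) \<partial>M)
        = (\<integral>\<^sup>+w. (if i' = i then 1 else 0) * indicator A w \<partial>M)"
      using 2 by (intro nn_integral_cong)
        (auto simp: indicator_def past_invariant[OF A] fun_upd_in_space)
    then show ?case using AM by simp
  qed simp
  also have "\<dots> = ennreal (p i) * emeasure M A" using i by simp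
  finally show ?thesis
    using p_pos[OF i]
    by (simp add: emeasure_eq_measure mult.commute measure_nonneg flip: ennreal_mult)
qed

lemma grad_coeff_eq:
  assumes i: "i \<le> CARD('d)"
  shows "AE w in M. grad_coeff M v k j i w = p i * v i $ j"
proof -
  interpret finite_measure_subalgebra M "past M k"
    by unfold_locales (rule subalgebra_past)
  let ?B = "{w \<in> space M. w k = i}"
  note marginal_event[OF i, of k, measurable]
  have "AE w in M. real_cond_exp M (past M k) (indicator ?B) w = p i"
  proof (rule real_cond_exp_charact)
    fix A assume A: "A \<in> sets (past M k)"
    then have [measurable]: "A \<in> sets M" using subalgebra_past by (auto simp: subalgebra_def)
    have "(\<integral>w\<in>A. indicator ?B w \<partial>M) = (\<integral>w. indicator (A \<inter> ?B) w \<partial>M)"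
      unfolding set_lebesgue_integral_def by (intro Bochner_Integration.integral_cong) (auto simp: indicator_def)
    also have "\<dots> = prob A * p i"
      using prob_past_inter[OF A i] by simp
    also have "\<dots> = (\<integral>w\<in>A. p i \<partial>M)"
      by (simp add: set_lebesgue_integral_def mult.commute)
    finally show "(\<integral>w\<in>A. indicator ?B w \<partial>M) = (\<integral>w\<in>A. p i \<partial>M)" .
  qed (auto simp: integrable_indicator_iff emeasure_eq_measure)
  then show ?thesis
    by eventually_elim (simp add: grad_coeff_def incr_def)
qed

end

section \<open>Symmetric kernels and insertion of a time index\<close>

lemma partial_integral_sum:
  "partial_integral v r f A w = (\<Sum>is\<in>A. partial_integral v r f {is} w)"
  by (simp add: partial_integral_def)

lemma sum_index_lists_permute:
  fixes g :: "'a list \<Rightarrow> real"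
  assumes "\<sigma> permutes {..<r}"
  shows "(\<Sum>ks | length ks = r. g (permute_list \<sigma> ks)) = (\<Sum>ks | length ks = r. g ks)"
proof (rule sum.reindex_bij_witness[where i = "permute_list (inv \<sigma>)" and j = "permute_list \<sigma>"])
  fix ks :: "'a list" assume ks: "ks \<in> {ks. length ks = r}"
  then show "permute_list (inv \<sigma>) (permute_list \<sigma> ks) = ks"
    using assms permutes_inv[OF assms]
    by (subst permute_list_compose[symmetric]) (auto simp: permutes_inv_o)
  show "permute_list \<sigma> (permute_list (inv \<sigma>) ks) = ks"
    using ks assms permutes_inv[OF assms]
    by (subst permute_list_compose[symmetric]) (auto simp: permutes_inv_o)
qed auto

text \<open>
  Permuting the time indices of a summand only permutes the summation over the upper indices,
  because the kernel is symmetric and the product of increments is commutative.  A time index \<open>k\<close>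
  occurring somewhere in a tuple can therefore be moved to the last place, which is where
  \<open>contract_kernel\<close> expects it.
\<close>

lemma partial_integral_permuted_index:
  fixes f :: "'d::finite list \<Rightarrow> nat list \<Rightarrow> real"
  assumes sym: "symmetric_kernel r f" and idx: "is \<in> Delta r" and mset: "mset is' = mset is"
  shows "partial_integral v r f {is'} w = partial_integral v r f {is} w"
proof -
  obtain \<sigma> where \<sigma>: "\<sigma> permutes {..<length is}" "permute_list \<sigma> is = is'"
    using mset by (rule mset_eq_permutation)
  have len: "length is = r" using idx by (simp add: Delta_def)
  have perm: "\<sigma> permutes {..<r}" using \<sigma> len by simp
  define W where "W ks is = (\<Prod>l<r. incr v (is ! l) w $ (ks ! l))" for ks :: "'d list" and "is"
  have W: "W (permute_list \<sigma> ks) is' = W ks is" if "length ks = r" for ks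
  proof -
    have "W (permute_list \<sigma> ks) is' = (\<Prod>l<r. incr v (is ! \<sigma> l) w $ (ks ! \<sigma> l))"
      unfolding W_def using that perm len
      by (intro prod.cong) (auto simp flip: \<sigma>(2) simp: permute_list_nth)
    also have "\<dots> = W ks is"
      unfolding W_def by (subst prod.permute[OF perm]) (simp add: o_def)
    finally show ?thesis .
  qed
  have "partial_integral v r f {is'} w
      = (\<Sum>ks | length ks = r. f (permute_list \<sigma> ks) is' * W (permute_list \<sigma> ks) is')"
    by (simp add: partial_integral_def flip: W_def)
      (rule sum_index_lists_permute[OF perm, of "\<lambda>ks. f ks is' * W ks is'", symmetric])
  also have "\<dots> = (\<Sum>ks | length ks = r. f ks is * W ks is)"
  proof (rule sum.cong)
    fix ks :: "'d list" assume "ks \<in> {ks. length ks = r}"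
    then have ks: "length ks = r" by simp
    then have "f (permute_list \<sigma> ks) is' = f ks is"
      using sym idx perm \<sigma>(2) unfolding symmetric_kernel_def by blast
    then show "f (permute_list \<sigma> ks) is' * W (permute_list \<sigma> ks) is' = f ks is * W ks is"
      by (simp add: W ks)
  qed simp
  also have "\<dots> = partial_integral v r f {is} w"
    by (simp add: partial_integral_def W_def)
  finally show ?thesis .
qed

lemma sum_index_lists_snoc:
  "(\<Sum>ks | length ks = Suc m. g ks) = (\<Sum>ks | length ks = m. \<Sum>a\<in>UNIV. g (ks @ [a]))"
  for g :: "'a::finite list \<Rightarrow> real"
proof -
  have "(\<Sum>ks | length ks = m. \<Sum>a\<in>UNIV. g (ks @ [a]))
      = (\<Sum>(ks, a)\<in>{ks. length ks = m} \<times> UNIV. g (ks @ [a]))"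
    by (simp add: sum.cartesian_product)
  also have "\<dots> = (\<Sum>ks | length ks = Suc m. g ks)"
    by (rule sum.reindex_bij_witness[where i = "\<lambda>ks. (butlast ks, last ks)"
          and j = "\<lambda>(ks, a). ks @ [a]"]) (auto simp: length_Suc_conv_rev)
  finally show ?thesis ..
qed

definition insert_at :: "nat \<Rightarrow> 'a \<Rightarrow> 'a list \<Rightarrow> 'a list" where
  "insert_at l x xs = take l xs @ x # drop l xs"

lemma mset_insert_at: "mset (insert_at l x xs) = mset (xs @ [x])"
proof -
  have "mset (take l xs) + mset (drop l xs) = mset xs"
    by (simp flip: mset_append)
  then show ?thesis by (simp add: insert_at_def)
qed

lemma insert_at_Delta:
  assumes "is \<in> Delta m" "k \<notin> set is"
  shows "insert_at l k is \<in> Delta (Suc m)" "is @ [k] \<in> Delta (Suc m)"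
  using assms mset_eq_length[OF mset_insert_at, of l k "is"]
    mset_eq_imp_distinct_iff[OF mset_insert_at, of l k "is"]
  by (auto simp: Delta_def)

text \<open>
  As \<open>x\<close> occurs exactly once in \<open>insert_at l x xs\<close>, its position and the rest of the list can be
  recovered; so the tuples containing \<open>k\<close> are counted without repetition by position and rest.
\<close>

lemma insert_at_inj:
  assumes eq: "insert_at l x xs = insert_at l' x xs'" and x: "x \<notin> set xs" "x \<notin> set xs'"
    and l: "l \<le> length xs" "l' \<le> length xs'"
  shows "l = l' \<and> xs = xs'"
proof -
  have "x \<notin> set (take l xs)" "x \<notin> set (take l' xs')" "x \<notin> set (drop l xs)" "x \<notin> set (drop l' xs')"
    using x by (auto dest: in_set_takeD in_set_dropD)
  then have "take l xs = take l' xs' \<and> drop l xs = drop l' xs'"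
    using eq unfolding insert_at_def by (metis append_Cons_eq_iff)
  then show ?thesis
    using l by (metis append_take_drop_id length_take min.absorb2)
qed

lemma insert_at_remove:
  assumes "is \<in> Delta (Suc m)" "k \<in> set is"
  obtains l where "l \<le> m" "remove1 k is \<in> Delta m" "k \<notin> set (remove1 k is)"
    "is = insert_at l k (remove1 k is)"
proof -
  obtain xs ys where "is = xs @ k # ys" "k \<notin> set xs"
    using assms(2) by (meson split_list_first)
  then show ?thesis
    using assms(1) by (intro that[of "length xs"]) (auto simp: Delta_def insert_at_def remove1_append)
qed

section \<open>The coordinate gradient\<close>

context iid_increments
begin

text \<open>
  The right-hand side of the claim with the coefficients \<open>p i * v i $ j\<close> in place of
  \<open>grad_coeff\<close>.  It is a version of the conditional expectation of \<open>F\<close> times the \<open>j\<close>-th component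
  of the \<open>k\<close>-th increment, given all coordinates other than \<open>k\<close>, whenever \<open>F\<close> is
  integrable.
\<close>

definition coordinate_gradient :: "nat \<Rightarrow> 'd \<Rightarrow> ((nat \<Rightarrow> nat) \<Rightarrow> real) \<Rightarrow> (nat \<Rightarrow> nat) \<Rightarrow> real" where
  "coordinate_gradient k j F w = (\<Sum>i\<le>CARD('d). p i * v i $ j * F (w(k := i)))"

lemma coordinate_gradient_diff:
  "coordinate_gradient k j (\<lambda>w. F w - G w) w
    = coordinate_gradient k j F w - coordinate_gradient k j G w"
  by (simp add: coordinate_gradient_def right_diff_distrib sum_subtractf)

lemma coordinate_gradient_sum:
  "coordinate_gradient k j (\<lambda>w. \<Sum>x\<in>S. F x w) w
    = (\<Sum>x\<in>S. coordinate_gradient k j (F x) w)"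
  by (simp add: coordinate_gradient_def sum_distrib_left) (rule sum.swap)

lemma coordinate_gradient_cmult:
  "coordinate_gradient k j (\<lambda>w. c * F w) w
    = c * coordinate_gradient k j F w"
  by (simp add: coordinate_gradient_def sum_distrib_left mult.left_commute)

lemma coordinate_gradient_unaffected:
  assumes "\<And>i. i \<le> CARD('d) \<Longrightarrow> F (w(k := i)) = c"
  shows "coordinate_gradient k j F w = 0"
  using increment_mean[of j] by (simp add: coordinate_gradient_def assms flip: sum_distrib_right)

lemma coordinate_gradient_cong_AE:
  assumes "AE w in M. F w = G w"
  shows "AE w in M. coordinate_gradient k j F w = coordinate_gradient k j G w"
proof -
  have "AE w in M. \<forall>i\<in>{..CARD('d)}. F (w(k := i)) = G (w(k := i))"
    using AE_resample[OF assms] by (intro AE_finite_allI) auto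
  then show ?thesis by eventually_elim (simp add: coordinate_gradient_def)
qed

lemma measurable_coordinate_gradient [measurable]:
  assumes [measurable]: "F \<in> borel_measurable M"
  shows "coordinate_gradient k j F \<in> borel_measurable M"
  unfolding coordinate_gradient_def by (intro borel_measurable_sum borel_measurable_times)
    (auto intro: measurable_compose[OF measurable_fun_upd_M assms])

text \<open>
  Cauchy--Schwarz for the weights \<open>p i\<close>, where \<open>(\<Sum>i. p i * (v i $ j)\<^sup>2) = 1\<close> is the unit variance of
  the increments.
\<close>

lemma coordinate_gradient_square_le:
  "(coordinate_gradient k j F w)\<^sup>2 \<le> (\<Sum>i\<le>CARD('d). p i * (F (w(k := i)))\<^sup>2)"
proof -
  have sq: "p i * x * y = (sqrt (p i) * x) * (sqrt (p i) * y)" if "i \<le> CARD('d)" for i x y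
    using p_pos[OF that] by simp
  have "(coordinate_gradient k j F w)\<^sup>2
      = (\<Sum>i\<le>CARD('d). (sqrt (p i) * v i $ j) * (sqrt (p i) * F (w(k := i))))\<^sup>2"
    unfolding coordinate_gradient_def
    by (intro arg_cong[where f = "\<lambda>x. x\<^sup>2"] sum.cong refl sq) simp
  also have "\<dots> \<le> (\<Sum>i\<le>CARD('d). (sqrt (p i) * v i $ j)\<^sup>2)
      * (\<Sum>i\<le>CARD('d). (sqrt (p i) * F (w(k := i)))\<^sup>2)"
    by (rule Cauchy_Schwarz_ineq_sum)
  also have "(\<Sum>i\<le>CARD('d). (sqrt (p i) * v i $ j)\<^sup>2) = 1"
    using increment_covariance[of j j] p_pos
    by (simp add: power_mult_distrib less_imp_le flip: power2_eq_square)
  also have "(\<Sum>i\<le>CARD('d). (sqrt (p i) * F (w(k := i)))\<^sup>2) = (\<Sum>i\<le>CARD('d). p i * (F (w(k := i)))\<^sup>2)"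
    using p_pos by (simp add: power_mult_distrib less_imp_le)
  finally show ?thesis by simp
qed

text \<open>
  Integrating the pointwise bound turns its right-hand side into the resampling formula for
  \<open>F\<^sup>2\<close>.
\<close>

lemma coordinate_gradient_L2_contraction:
  assumes F [measurable]: "F \<in> borel_measurable M" and F2: "integrable M (\<lambda>w. (F w)\<^sup>2)"
  shows "integrable M (\<lambda>w. (coordinate_gradient k j F w)\<^sup>2)"
    and "(\<integral>w. (coordinate_gradient k j F w)\<^sup>2 \<partial>M) \<le> (\<integral>w. (F w)\<^sup>2 \<partial>M)"
proof -
  have upd [measurable]: "(\<lambda>w. F (w(k := i))) \<in> borel_measurable M" if "i \<le> CARD('d)" for i
    using that by (rule measurable_compose[OF measurable_fun_upd_M F])
  have "(\<integral>\<^sup>+w. ennreal ((coordinate_gradient k j F w)\<^sup>2) \<partial>M)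
      \<le> (\<integral>\<^sup>+w. (\<Sum>i\<le>CARD('d). ennreal (p i) * ennreal ((F (w(k := i)))\<^sup>2)) \<partial>M)"
  proof (rule nn_integral_mono)
    fix w
    have "ennreal ((coordinate_gradient k j F w)\<^sup>2) \<le> ennreal (\<Sum>i\<le>CARD('d). p i * (F (w(k := i)))\<^sup>2)"
      by (rule ennreal_leI[OF coordinate_gradient_square_le])
    also have "\<dots> = (\<Sum>i\<le>CARD('d). ennreal (p i) * ennreal ((F (w(k := i)))\<^sup>2))"
      using p_pos by (subst sum_ennreal[symmetric]) (auto simp: less_imp_le ennreal_mult)
    finally show "ennreal ((coordinate_gradient k j F w)\<^sup>2) \<le> \<dots>" .
  qed
  also have "\<dots> = (\<Sum>i\<le>CARD('d). ennreal (p i) * (\<integral>\<^sup>+w. ennreal ((F (w(k := i)))\<^sup>2) \<partial>M))"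
    by (subst nn_integral_sum) (auto intro!: sum.cong simp: nn_integral_cmult)
  also have "\<dots> = (\<integral>\<^sup>+w. ennreal ((F w)\<^sup>2) \<partial>M)"
    by (rule nn_integral_resample[symmetric]) simp
  finally have le: "(\<integral>\<^sup>+w. ennreal ((coordinate_gradient k j F w)\<^sup>2) \<partial>M) \<le> (\<integral>\<^sup>+w. ennreal ((F w)\<^sup>2) \<partial>M)" .
  have fin: "(\<integral>\<^sup>+w. ennreal ((F w)\<^sup>2) \<partial>M) < \<infinity>"
    using F2 by (simp add: nn_integral_eq_integral)
  show int: "integrable M (\<lambda>w. (coordinate_gradient k j F w)\<^sup>2)"
    using le fin by (intro integrableI_nonneg) auto
  show "(\<integral>w. (coordinate_gradient k j F w)\<^sup>2 \<partial>M) \<le> (\<integral>w. (F w)\<^sup>2 \<partial>M)"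
    using le by (simp add: nn_integral_eq_integral[OF int] nn_integral_eq_integral[OF F2])
qed

section \<open>The coordinate gradient of finite sums\<close>

lemma coordinate_gradient_partial_integral_absent:
  assumes "k \<notin> set is" "length is = r"
  shows "coordinate_gradient k j (partial_integral v r f {is}) w = 0"
proof (rule coordinate_gradient_unaffected)
  have ne: "is ! l \<noteq> k" if "l < r" for l using assms that by force
  have "(\<Prod>l<r. incr v (is ! l) (w(k := i)) $ (ks ! l)) = (\<Prod>l<r. incr v (is ! l) w $ (ks ! l))"
    for ks :: "'d list" and i
    by (intro prod.cong) (auto simp: incr_def ne)
  then show "partial_integral v r f {is} (w(k := i)) = partial_integral v r f {is} w" for i
    by (simp add: partial_integral_def)
qed

text \<open>
  Resampling affects the last factor alone, and the orthonormality of the components of an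
  increment selects the upper index \<open>j\<close> for it.
\<close>

lemma coordinate_gradient_partial_integral_last:
  assumes k: "k \<notin> set is" and len: "length is = m"
  shows "coordinate_gradient k j (partial_integral v (Suc m) f {is @ [k]}) w
       = partial_integral v m (contract_kernel f j k) {is} w"
proof -
  define W where "W ks = (\<Prod>l<m. incr v (is ! l) w $ (ks ! l))" for ks :: "'d list"
  have W: "(\<Prod>l<Suc m. incr v ((is @ [k]) ! l) (w(k := i)) $ ((ks @ [a]) ! l)) = W ks * v i $ a"
    if "length ks = m" for ks :: "'d list" and a i
  proof -
    have "(\<Prod>l<m. incr v ((is @ [k]) ! l) (w(k := i)) $ ((ks @ [a]) ! l)) = W ks"
      unfolding W_def
    proof (rule prod.cong)
      fix l assume "l \<in> {..<m}"
      then have "is ! l \<noteq> k" "l < length is" using k len by force+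
      then show "incr v ((is @ [k]) ! l) (w(k := i)) $ ((ks @ [a]) ! l) = incr v (is ! l) w $ (ks ! l)"
        using that len by (simp add: nth_append incr_def)
    qed simp
    moreover have "incr v ((is @ [k]) ! m) (w(k := i)) $ ((ks @ [a]) ! m) = v i $ a"
      using that len by (simp add: nth_append incr_def)
    ultimately show ?thesis by (simp only: prod.lessThan_Suc)
  qed
  have "partial_integral v (Suc m) f {is @ [k]} (w(k := i))
      = (\<Sum>ks | length ks = m. \<Sum>a\<in>UNIV. f (ks @ [a]) (is @ [k]) * (W ks * v i $ a))" for i
    unfolding partial_integral_def sum_index_lists_snoc
    by (simp add: W del: prod.lessThan_Suc)
  then have "coordinate_gradient k j (partial_integral v (Suc m) f {is @ [k]}) w
      = coordinate_gradient k j (\<lambda>w'. \<Sum>ks | length ks = m. \<Sum>a\<in>UNIV. f (ks @ [a]) (is @ [k]) * W ks * v (w' k) $ a) w"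
    by (simp add: coordinate_gradient_def mult.assoc)
  also have "\<dots> = (\<Sum>ks | length ks = m. \<Sum>a\<in>UNIV. f (ks @ [a]) (is @ [k]) * W ks *
      coordinate_gradient k j (\<lambda>w'. v (w' k) $ a) w)"
    by (simp add: coordinate_gradient_sum coordinate_gradient_cmult)
  also have "\<dots> = (\<Sum>ks | length ks = m. \<Sum>a\<in>UNIV. if a = j then f (ks @ [j]) (is @ [k]) * W ks else 0)"
    by (intro sum.cong) (auto simp: coordinate_gradient_def mult.assoc increment_covariance)
  also have "\<dots> = partial_integral v m (contract_kernel f j k) {is} w"
    using k by (simp add: partial_integral_def contract_kernel_def W_def)
  finally show ?thesis .
qed

text \<open>
  The finite index set is split into tuples \<open>B\<close> that avoid \<open>k\<close>, which contribute nothing, and tuples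
  \<open>C\<close> obtained by inserting \<open>k\<close> at each of the \<open>Suc m\<close> positions of a tuple of \<open>A\<close> that avoids
  \<open>k\<close>, all positions contributing equally.  Keeping \<open>B\<close> arbitrary matters for the limit: adjoining tuples that avoid \<open>k\<close>
  makes \<open>B \<union> C\<close> exceed any given finite set of indices without changing the result.
\<close>

lemma coordinate_gradient_partial_integral:
  assumes sym: "symmetric_kernel (Suc m) f"
    and A: "finite A" "A \<subseteq> Delta m"
    and B: "finite B" "B \<subseteq> Delta (Suc m)" "\<And>is. is \<in> B \<Longrightarrow> k \<notin> set is"
  defines "C \<equiv> (\<lambda>(l, is). insert_at l k is) ` ({..m} \<times> {is \<in> A. k \<notin> set is})"
  shows "coordinate_gradient k j (partial_integral v (Suc m) f (B \<union> C)) w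
       = real (Suc m) * partial_integral v m (contract_kernel f j k) A w"
proof -
  let ?g = "contract_kernel f j k" and ?A = "{is \<in> A. k \<notin> set is}"
  define T where "T is = coordinate_gradient k j (partial_integral v (Suc m) f {is}) w" for "is"
  have len: "length is = m" if "is \<in> A" for "is" using that A by (auto simp: Delta_def)
  have inj: "inj_on (\<lambda>(l, is). insert_at l k is) ({..m} \<times> ?A)"
  proof (rule inj_onI)
    fix x y assume "x \<in> {..m} \<times> ?A" "y \<in> {..m} \<times> ?A"
      "(case x of (l, is) \<Rightarrow> insert_at l k is) = (case y of (l, is) \<Rightarrow> insert_at l k is)"
    then show "x = y"
      using insert_at_inj[of "fst x" k "snd x" "fst y" "snd y"] len
      by (auto simp: prod_eq_iff split_beta)
  qed
  have T_insert: "T (insert_at l k is) = partial_integral v m ?g {is} w" if "is \<in> ?A" for l "is"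
  proof -
    have "partial_integral v (Suc m) f {insert_at l k is} = partial_integral v (Suc m) f {is @ [k]}"
      using that A by (intro ext partial_integral_permuted_index[OF sym] insert_at_Delta mset_insert_at) auto
    then show ?thesis
      using that len by (simp add: T_def coordinate_gradient_partial_integral_last)
  qed
  have "coordinate_gradient k j (partial_integral v (Suc m) f (B \<union> C)) w = (\<Sum>is\<in>B \<union> C. T is)"
    unfolding T_def by (subst coordinate_gradient_sum[symmetric]) (simp flip: partial_integral_sum)
  also have "\<dots> = (\<Sum>is\<in>B. T is) + (\<Sum>is\<in>C. T is)"
  proof (rule sum.union_disjoint)
    have "k \<in> set idx" if "idx \<in> C" for idx
      using that by (auto simp: C_def insert_at_def)
    then show "B \<inter> C = {}" using B(3) by blast
  qed (use A B in \<open>auto simp: C_def\<close>)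
  also have "(\<Sum>is\<in>B. T is) = 0"
    using B by (intro sum.neutral) (auto simp: T_def Delta_def intro!: coordinate_gradient_partial_integral_absent)
  also have "(\<Sum>is\<in>C. T is) = (\<Sum>(l, is)\<in>{..m} \<times> ?A. T (insert_at l k is))"
    unfolding C_def by (subst sum.reindex[OF inj]) (simp add: case_prod_unfold)
  also have "\<dots> = (\<Sum>(l, is)\<in>{..m} \<times> ?A. partial_integral v m ?g {is} w)"
    by (intro sum.cong) (auto simp: T_insert)
  also have "\<dots> = real (Suc m) * (\<Sum>is\<in>?A. partial_integral v m ?g {is} w)"
    by (simp flip: sum.cartesian_product)
  also have "(\<Sum>is\<in>?A. partial_integral v m ?g {is} w) = partial_integral v m ?g A w"
    unfolding partial_integral_sum[of v m ?g A]
    using A by (intro sum.mono_neutral_left) (auto simp: partial_integral_def contract_kernel_def)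
  finally show ?thesis by simp
qed

section \<open>Passage to multiple integrals\<close>

lemma measurable_partial_integral [measurable]:
  "partial_integral v r f A \<in> borel_measurable M"
proof -
  have "(\<lambda>w. incr v n w $ a) \<in> borel_measurable M" for n a
    unfolding incr_def by (rule measurable_fun_coordinate)
  then show ?thesis
    unfolding partial_integral_def
    by (intro borel_measurable_sum borel_measurable_times borel_measurable_const
        borel_measurable_prod)
qed

text \<open>
  The finite sums are bounded on \<open>space M\<close>, where the increments take finitely many values.
\<close>

lemma integrable_partial_integral_square: "integrable M (\<lambda>w. (partial_integral v r f A w)\<^sup>2)"
proof -
  define K where "K = (\<Sum>i\<le>CARD('d). norm (v i))"
  define B where "B = (\<Sum>is\<in>A. \<Sum>ks | length ks = r. \<bar>f ks is\<bar> * K ^ r)"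
  have incr_le: "\<bar>incr v n w $ a\<bar> \<le> K" if "w \<in> space M" for w n a
  proof -
    have "\<bar>incr v n w $ a\<bar> \<le> norm (v (w n))"
      unfolding incr_def by (rule component_le_norm_cart)
    also have "\<dots> \<le> K"
      unfolding K_def using coordinate_le[OF that] by (intro member_le_sum) auto
    finally show ?thesis .
  qed
  have "\<bar>partial_integral v r f A w\<bar> \<le> B" if w: "w \<in> space M" for w
  proof -
    have "\<bar>\<Prod>l<r. incr v (is ! l) w $ (ks ! l)\<bar> \<le> K ^ r" for "is" and ks :: "'d list"
      using prod_mono[of "{..<r}" "\<lambda>l. \<bar>incr v (is ! l) w $ (ks ! l)\<bar>" "\<lambda>_. K"] incr_le[OF w]
      by (simp add: abs_prod)
    then show ?thesis
      unfolding partial_integral_def B_def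
      by (intro order_trans[OF sum_abs] sum_mono) (simp add: abs_mult mult_left_mono)
  qed
  then have "(partial_integral v r f A w)\<^sup>2 \<le> B\<^sup>2" if "w \<in> space M" for w
    using that power_mono[of "\<bar>partial_integral v r f A w\<bar>" B 2] by simp
  then have "AE w in M. norm ((partial_integral v r f A w)\<^sup>2) \<le> B\<^sup>2"
    by (intro AE_I2) simp
  then show ?thesis
    by (rule integrable_const_bound) measurable
qed

lemma integrable_square_diff:
  fixes F G :: "(nat \<Rightarrow> nat) \<Rightarrow> real"
  assumes [measurable]: "F \<in> borel_measurable M" "G \<in> borel_measurable M"
    and "integrable M (\<lambda>w. (F w)\<^sup>2)" "integrable M (\<lambda>w. (G w)\<^sup>2)"
  shows "integrable M (\<lambda>w. (F w - G w)\<^sup>2)"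
proof (rule Bochner_Integration.integrable_bound)
  show "integrable M (\<lambda>w. 2 * (F w)\<^sup>2 + 2 * (G w)\<^sup>2)" using assms by simp
  have "(x - y)\<^sup>2 \<le> 2 * x\<^sup>2 + 2 * y\<^sup>2" for x y :: real
    using zero_le_power2[of "x + y"] by (simp add: power2_eq_square algebra_simps)
  then show "AE w in M. norm ((F w - G w)\<^sup>2) \<le> norm (2 * (F w)\<^sup>2 + 2 * (G w)\<^sup>2)"
    by (intro AE_I2) auto
qed measurable

lemma has_multiple_integral_unique:
  assumes "has_multiple_integral M v r f F" "has_multiple_integral M v r f G"
  shows "AE w in M. F w = G w"
proof -
  let ?P = "partial_integral v r f"
  note F = assms(1)[unfolded has_multiple_integral_def]
  note G = assms(2)[unfolded has_multiple_integral_def]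
  have [measurable]: "F \<in> borel_measurable M" "G \<in> borel_measurable M" using F G by auto
  have int: "integrable M (\<lambda>w. (F w - G w)\<^sup>2)" "\<And>A. integrable M (\<lambda>w. (F w - ?P A w)\<^sup>2)"
    "\<And>A. integrable M (\<lambda>w. (G w - ?P A w)\<^sup>2)"
    using F G by (auto intro!: integrable_square_diff integrable_partial_integral_square)
  have "(\<integral>w. (F w - G w)\<^sup>2 \<partial>M) \<le> 2 * (\<integral>w. (F w - ?P A w)\<^sup>2 \<partial>M) + 2 * (\<integral>w. (G w - ?P A w)\<^sup>2 \<partial>M)" for A
  proof -
    \<comment> \<open>The parallelogram inequality for \<open>x - z\<close> and \<open>y - z\<close>.\<close>
    have "(x - y)\<^sup>2 \<le> 2 * (x - z)\<^sup>2 + 2 * (y - z)\<^sup>2" for x y z :: real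
      using zero_le_power2[of "(x - z) + (y - z)"] by (simp add: power2_eq_square algebra_simps)
    then have "(\<integral>w. (F w - G w)\<^sup>2 \<partial>M) \<le> (\<integral>w. 2 * (F w - ?P A w)\<^sup>2 + 2 * (G w - ?P A w)\<^sup>2 \<partial>M)"
      using int by (intro integral_mono) auto
    then show ?thesis using int by simp
  qed
  moreover have "((\<lambda>A. 2 * (\<integral>w. (F w - ?P A w)\<^sup>2 \<partial>M) + 2 * (\<integral>w. (G w - ?P A w)\<^sup>2 \<partial>M))
      \<longlongrightarrow> 2 * 0 + 2 * 0) (finite_subsets_at_top (Delta r))"
    using F G by (intro tendsto_intros) auto
  ultimately have "(\<integral>w. (F w - G w)\<^sup>2 \<partial>M) \<le> 2 * 0 + 2 * 0"
    by (intro tendsto_lowerbound[OF _ always_eventually]) auto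
  then have "(\<integral>w. (F w - G w)\<^sup>2 \<partial>M) = 0"
    by (intro antisym) auto
  then show ?thesis
    using int(1) by (subst (asm) integral_nonneg_eq_0_iff_AE) auto
qed

lemma has_multiple_integral_0: "has_multiple_integral M v 0 f (\<lambda>_. f [] [])"
proof -
  have Delta_0: "Delta 0 = {[]}" by (auto simp: Delta_def)
  have "partial_integral v 0 f {[]} w = f [] []" for w
    by (simp add: partial_integral_def)
  then have "\<forall>\<^sub>F A in finite_subsets_at_top (Delta 0).
      (\<integral>w. (f [] [] - partial_integral v 0 f A w)\<^sup>2 \<partial>M) = 0"
    by (simp add: Delta_0 finite_subsets_at_top_finite eventually_principal)
  then show ?thesis
    unfolding has_multiple_integral_def by (simp add: tendsto_eventually)
qed

text \<open>
  The contraction property transports convergence.  If the finite sums over all index sets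
  containing \<open>X\<close> have squared distance below \<open>e\<close> from \<open>F\<close>, then a finite set \<open>A\<close> of shorter tuples containing the tuples
  of \<open>X\<close> with \<open>k\<close> deleted can be extended, by inserting \<open>k\<close> and adjoining the tuples of \<open>X\<close>
  without \<open>k\<close>, to an index set \<open>Y\<close> containing \<open>X\<close>.  The coordinate gradient of the sum over \<open>Y\<close> is
  \<open>Suc m\<close> times the contracted sum over \<open>A\<close>.
\<close>

lemma has_multiple_integral_contract:
  assumes sym: "symmetric_kernel (Suc m) f"
    and F: "has_multiple_integral M v (Suc m) f F"
  shows "has_multiple_integral M v m (contract_kernel f j k)
    (\<lambda>w. coordinate_gradient k j F w / real (Suc m))"
proof -
  let ?P = "partial_integral v (Suc m) f"
  let ?Q = "partial_integral v m (contract_kernel f j k)"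
  have F_meas [measurable]: "F \<in> borel_measurable M" and F2: "integrable M (\<lambda>w. (F w)\<^sup>2)"
    and F_lim: "((\<lambda>A. \<integral>w. (F w - ?P A w)\<^sup>2 \<partial>M) \<longlongrightarrow> 0) (finite_subsets_at_top (Delta (Suc m)))"
    using F by (auto simp: has_multiple_integral_def)
  have "((\<lambda>A. \<integral>w. (coordinate_gradient k j F w / real (Suc m) - ?Q A w)\<^sup>2 \<partial>M) \<longlongrightarrow> 0)
      (finite_subsets_at_top (Delta m))"
  proof (rule tendstoI)
    fix e :: real assume "e > 0"
    with F_lim have "\<forall>\<^sub>F A in finite_subsets_at_top (Delta (Suc m)). (\<integral>w. (F w - ?P A w)\<^sup>2 \<partial>M) < e"
      by (rule order_tendstoD)
    then obtain X where X: "finite X" "X \<subseteq> Delta (Suc m)"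
      and X_small: "\<And>Y. finite Y \<Longrightarrow> X \<subseteq> Y \<Longrightarrow> Y \<subseteq> Delta (Suc m) \<Longrightarrow> (\<integral>w. (F w - ?P Y w)\<^sup>2 \<partial>M) < e"
      by (auto simp: eventually_finite_subsets_at_top)
    define B where "B = {is \<in> X. k \<notin> set is}"
    \<comment> \<open>The tuples of \<open>X\<close> that contain \<open>k\<close>, with this entry deleted.\<close>
    define X' where "X' = remove1 k ` {is \<in> X. k \<in> set is}"
    have "remove1 k idx \<in> Delta m" if "idx \<in> X" "k \<in> set idx" for idx
      using insert_at_remove[of idx m k] that X(2) by blast
    then have X': "finite X'" "X' \<subseteq> Delta m"
      using X(1) by (auto simp: X'_def)
    have "(\<integral>w. (coordinate_gradient k j F w / real (Suc m) - ?Q A w)\<^sup>2 \<partial>M) < e"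
      if A: "finite A" "X' \<subseteq> A" "A \<subseteq> Delta m" for A
    proof -
      define Y where "Y = B \<union> (\<lambda>(l, is). insert_at l k is) ` ({..m} \<times> {is \<in> A. k \<notin> set is})"
      have "X \<subseteq> Y"
      proof
        fix idx assume idx: "idx \<in> X"
        show "idx \<in> Y"
        proof (cases "k \<in> set idx")
          case True
          with idx X obtain l where l: "l \<le> m" "k \<notin> set (remove1 k idx)"
            "idx = insert_at l k (remove1 k idx)"
            using insert_at_remove[of idx m k] by blast
          moreover have "remove1 k idx \<in> A" using True idx A(2) by (auto simp: X'_def)
          ultimately have "(l, remove1 k idx) \<in> {..m} \<times> {is \<in> A. k \<notin> set is}" by auto
          then have "(case (l, remove1 k idx) of (l, is) \<Rightarrow> insert_at l k is) \<in> Y"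
            unfolding Y_def by blast
          with l(3) show ?thesis by simp
        qed (use idx in \<open>simp add: Y_def B_def\<close>)
      qed
      moreover have "finite Y" "Y \<subseteq> Delta (Suc m)"
        using X A by (auto simp: Y_def B_def intro: insert_at_Delta)
      ultimately have small: "(\<integral>w. (F w - ?P Y w)\<^sup>2 \<partial>M) < e"
        by (intro X_small)
      have "coordinate_gradient k j (?P Y) w = real (Suc m) * ?Q A w" for w
        unfolding Y_def using X A by (intro coordinate_gradient_partial_integral[OF sym]) (auto simp: B_def)
      then have eq: "coordinate_gradient k j F w / real (Suc m) - ?Q A w
          = coordinate_gradient k j (\<lambda>w. F w - ?P Y w) w / real (Suc m)" for w
        by (simp add: coordinate_gradient_diff field_simps)
      have "(\<integral>w. (coordinate_gradient k j F w / real (Suc m) - ?Q A w)\<^sup>2 \<partial>M)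
          = (\<integral>w. (coordinate_gradient k j (\<lambda>w. F w - ?P Y w) w)\<^sup>2 \<partial>M) / (real (Suc m))\<^sup>2"
        by (simp only: eq power_divide integral_divide_zero)
      also have "\<dots> \<le> (\<integral>w. (coordinate_gradient k j (\<lambda>w. F w - ?P Y w) w)\<^sup>2 \<partial>M) / 1"
        by (intro divide_left_mono) auto
      also have "\<dots> \<le> (\<integral>w. (F w - ?P Y w)\<^sup>2 \<partial>M)"
        using F2 by (simp, intro coordinate_gradient_L2_contraction integrable_square_diff
            integrable_partial_integral_square) auto
      finally show ?thesis using small by simp
    qed
    then show "\<forall>\<^sub>F A in finite_subsets_at_top (Delta m).
        dist (\<integral>w. (coordinate_gradient k j F w / real (Suc m) - ?Q A w)\<^sup>2 \<partial>M) 0 < e"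
      using X' by (auto simp: eventually_finite_subsets_at_top)
  qed
  then show ?thesis
    using coordinate_gradient_L2_contraction(1)[OF F_meas F2, of k j]
    by (simp add: has_multiple_integral_def power_divide)
qed

section \<open>The gradient of a chaos expansion\<close>

text \<open>
  The left-hand side depends on the chosen expansion of \<open>F\<close>, the right-hand side does not: this is
  what makes the gradient well defined.
\<close>

lemma gradient_series_eq_coordinate_gradient:
  assumes F: "chaos_expansion M v n f F"
    and J: "\<And>r. r \<in> {1..n} \<Longrightarrow> has_multiple_integral M v (r - 1) (contract_kernel (f r) j k) (J r)"
  shows "AE w in M. (\<Sum>r=1..n. real r * J r w) = coordinate_gradient k j F w"
proof -
  obtain I where I: "\<And>r. r \<le> n \<Longrightarrow> has_multiple_integral M v r (f r) (I r)"
    and FI: "AE w in M. F w = (\<Sum>r\<le>n. I r w)" and symm: "\<And>r. r \<le> n \<Longrightarrow> symmetric_kernel r (f r)"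
    using F by (auto simp: chaos_expansion_def)
  have "AE w in M. I 0 w = f 0 [] []"
    using I[of 0] has_multiple_integral_0 by (intro has_multiple_integral_unique) auto
  from coordinate_gradient_cong_AE[OF this]
  have I0: "AE w in M. coordinate_gradient k j (I 0) w = 0"
    by (simp add: coordinate_gradient_unaffected)
  have "AE w in M. real r * J r w = coordinate_gradient k j (I r) w" if r: "r \<in> {1..n}" for r
  proof -
    obtain m where m: "r = Suc m" using r by (cases r) auto
    have "AE w in M. J r w = coordinate_gradient k j (I r) w / real r"
      using J[OF r] has_multiple_integral_contract[of m "f r" "I r" j k] symm[of r] I[of r] r
      by (intro has_multiple_integral_unique[of m "contract_kernel (f r) j k"]) (auto simp: m)
    then show ?thesis by eventually_elim (use r in auto)
  qed
  then have "AE w in M. \<forall>r\<in>{1..n}. real r * J r w = coordinate_gradient k j (I r) w"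
    by (intro AE_finite_allI) auto
  then show ?thesis
    using I0 coordinate_gradient_cong_AE[OF FI, of k j]
  proof eventually_elim
    case (elim w)
    have "{..n} = insert 0 {1..n}" by auto
    moreover have "coordinate_gradient k j F w = (\<Sum>r\<le>n. coordinate_gradient k j (I r) w)"
      using elim(3) by (simp only: coordinate_gradient_sum)
    ultimately have "coordinate_gradient k j F w = (\<Sum>r=1..n. coordinate_gradient k j (I r) w)"
      using elim(2) by simp
    then show ?case using elim(1) by simp
  qed
qed

text \<open>
  The predicate defining \<open>gradient\<close> is satisfiable, the coordinate gradient itself being a witness,
  and by \<open>gradient_series_eq_coordinate_gradient\<close> all functions satisfying it agree almost surely.
\<close>

lemma gradient_eq_coordinate_gradient:
  assumes "F \<in> chaos_space M v"
  shows "AE w in M. gradient M v k j F w = coordinate_gradient k j F w"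
proof -
  let ?Q = "\<lambda>G. \<exists>n f J. chaos_expansion M v n f F \<and>
        (\<forall>r\<in>{1..n}. has_multiple_integral M v (r - 1) (contract_kernel (f r) j k) (J r)) \<and>
        G \<in> borel_measurable M \<and> (AE w in M. G w = (\<Sum>r=1..n. real r * J r w))"
  obtain n f where F: "chaos_expansion M v n f F"
    using assms by (auto simp: chaos_space_def)
  then obtain I where I: "\<And>r. r \<le> n \<Longrightarrow> has_multiple_integral M v r (f r) (I r)"
    and symm: "\<And>r. r \<le> n \<Longrightarrow> symmetric_kernel r (f r)"
    by (auto simp: chaos_expansion_def)
  have J: "has_multiple_integral M v (r - 1) (contract_kernel (f r) j k)
      (\<lambda>w. coordinate_gradient k j (I r) w / real r)" if "r \<in> {1..n}" for r
    using that has_multiple_integral_contract[of "r - 1" "f r" "I r" j k] symm[of r] I[of r]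
    by auto
  have "?Q (coordinate_gradient k j F)"
  proof (intro exI conjI ballI)
    show "coordinate_gradient k j F \<in> borel_measurable M"
      using F by (auto simp: chaos_expansion_def)
    have "AE w in M. (\<Sum>r=1..n. real r * (coordinate_gradient k j (I r) w / real r)) = coordinate_gradient k j F w"
      using F J by (rule gradient_series_eq_coordinate_gradient)
    then show "AE w in M. coordinate_gradient k j F w = (\<Sum>r=1..n. real r * (coordinate_gradient k j (I r) w / real r))"
      by eventually_elim (rule sym)
  qed (use F J in auto)
  then have "?Q (gradient M v k j F)"
    unfolding gradient_def by (rule someI[of ?Q])
  then obtain n f J where *: "chaos_expansion M v n f F"
    "\<And>r. r \<in> {1..n} \<Longrightarrow> has_multiple_integral M v (r - 1) (contract_kernel (f r) j k) (J r)"
    "AE w in M. gradient M v k j F w = (\<Sum>r=1..n. real r * J r w)"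
    by blast
  have "AE w in M. (\<Sum>r=1..n. real r * J r w) = coordinate_gradient k j F w"
    using *(1,2) by (rule gradient_series_eq_coordinate_gradient)
  with *(3) show ?thesis
    by eventually_elim simp
qed

end

theorem proposition6p8:
  fixes M :: "(nat \<Rightarrow> nat) measure"
    and p :: "nat \<Rightarrow> real"
    and v :: "nat \<Rightarrow> real ^ 'd::finite"
    and F :: "(nat \<Rightarrow> nat) \<Rightarrow> real"
    and k :: nat
    and j :: 'd
  assumes "prob_space M"
    and "sets M = sets (Pi\<^sub>M (UNIV :: nat set) (\<lambda>_. count_space {0..CARD('d)}))"
    and "prob_space.indep_vars M (\<lambda>_. count_space {0..CARD('d)}) (\<lambda>n w. w n) (UNIV :: nat set)"
    and "\<And>n i. i \<le> CARD('d) \<Longrightarrow> measure M {w \<in> space M. w n = i} = p i"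
    and "\<And>i. i \<le> CARD('d) \<Longrightarrow> p i > 0"
    and "\<And>n a. (\<integral>w. incr v n w $ a \<partial>M) = 0"
    and "\<And>n a b. (\<integral>w. incr v n w $ a * incr v n w $ b \<partial>M) = (if a = b then 1 else 0)"
    and "F \<in> chaos_space M v"
  shows "AE w in M.
           (\<forall>i\<le>CARD('d). grad_coeff M v k j i w = p i * v i $ j) \<and>
           gradient M v k j F w = (\<Sum>i\<le>CARD('d). grad_coeff M v k j i w * F (w(k := i)))"
proof -
  interpret iid_increments M p v
    by (rule iid_increments.intro, fact assms(1), rule iid_increments_axioms.intro) (fact assms)+
  have "AE w in M. \<forall>i\<in>{..CARD('d)}. grad_coeff M v k j i w = p i * v i $ j"
    by (intro AE_finite_allI finite_atMost grad_coeff_eq) simp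
  with gradient_eq_coordinate_gradient[OF assms(8), of k j] show ?thesis
    by eventually_elim (simp add: coordinate_gradient_def)
qed

end
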